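(* Let $n\geq 2$ be an integer. If $A$ is a non-empty subset of $U(n)$, then $D_{A,\mathbb Z_n'}(n)=D_A(n)+1$. If $A\subseteq\mathbb Z_n'$ is non-empty and $A\not\subseteq U(n)$, then $D_{A,\mathbb Z_n'}(n)=D_A(n)$.
   Context: $\mathbb Z_n=\mathbb Z/n\mathbb Z$ as a module over itself, $\mathbb Z_n'=\mathbb Z_n\setminus\{0\}$, and $U(n)$ is the group of units of $\mathbb Z_n$. A subsequence is a non-empty subfamily of terms in the original order. A sequence $(x_1,\ldots,x_k)$ is an $A$-weighted zero-sum sequence if there exist $a_i\in A$ with $\sum a_ix_i=0$, and an $(A,B)$-weighted zero-sum sequence if there exist $a_i\in A$, $b_i\in B$ with $\sum a_ix_i=0$ and $\sum b_ia_i=0$. $D_{A,B}(n)$ (resp. $D_A(n)$) is the least positive $k$ such that every sequence of length $k$ in $\mathbb Z_n$ has an $(A,B)$-weighted (resp. $A$-weighted) zero-sum subsequence. *)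

theory Defs
  imports "HOL-Number_Theory.Residues" "HOL-Library.Sublist"
begin

text \<open>
  The ring of integers modulo \<open>n\<close> is \<^term>\<open>residue_ring (int n)\<close>, whose carrier is \<open>{0..n - 1}\<close>
  with operations modulo \<open>n\<close>; the library makes it a ring for \<open>n \<ge> 2\<close>.
  Sequences, and families of weights indexed by their terms, are lists.
\<close>

abbreviation Zmod :: "nat \<Rightarrow> int ring" where
  "Zmod n \<equiv> residue_ring (int n)"

definition nonzero_residues :: "nat \<Rightarrow> int set" where
  "nonzero_residues n = carrier (Zmod n) - {\<zero>\<^bsub>Zmod n\<^esub>}"

definition weighted_sum :: "nat \<Rightarrow> int list \<Rightarrow> int list \<Rightarrow> int" where
  "weighted_sum n as xs =
     (\<Oplus>\<^bsub>Zmod n\<^esub> i \<in> {..<length xs}. as ! i \<otimes>\<^bsub>Zmod n\<^esub> xs ! i)"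

definition weighted_zero_sum :: "nat \<Rightarrow> int set \<Rightarrow> int list \<Rightarrow> bool" where
  "weighted_zero_sum n A xs \<longleftrightarrow>
     (\<exists>as. length as = length xs \<and> set as \<subseteq> A \<and> weighted_sum n as xs = \<zero>\<^bsub>Zmod n\<^esub>)"

definition weighted_zero_sum2 :: "nat \<Rightarrow> int set \<Rightarrow> int set \<Rightarrow> int list \<Rightarrow> bool" where
  "weighted_zero_sum2 n A B xs \<longleftrightarrow>
     (\<exists>as bs. length as = length xs \<and> set as \<subseteq> A \<and>
              length bs = length xs \<and> set bs \<subseteq> B \<and>
              weighted_sum n as xs = \<zero>\<^bsub>Zmod n\<^esub> \<and>
              weighted_sum n bs as = \<zero>\<^bsub>Zmod n\<^esub>)"

text \<open>
  The condition \<open>ys \<noteq> []\<close> matters: the empty list is a \<^const>\<open>subseq\<close> of every list and has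
  weighted sum zero. The value of \<open>LEAST\<close> is meaningful only if some \<open>k\<close> has the property. For
  \<open>davenport_const\<close> and nonempty \<open>A\<close>, already \<open>k = n\<close> has it: apply the pigeonhole principle to
  the partial sums of a sequence, using one constant weight from \<open>A\<close>.
\<close>

definition davenport_const :: "int set \<Rightarrow> nat \<Rightarrow> nat" where
  "davenport_const A n =
     (LEAST k. 0 < k \<and>
        (\<forall>xs. length xs = k \<and> set xs \<subseteq> carrier (Zmod n) \<longrightarrow>
           (\<exists>ys. ys \<noteq> [] \<and> subseq ys xs \<and> weighted_zero_sum n A ys)))"

definition davenport_const2 :: "int set \<Rightarrow> int set \<Rightarrow> nat \<Rightarrow> nat" where
  "davenport_const2 A B n =
     (LEAST k. 0 < k \<and>
        (\<forall>xs. length xs = k \<and> set xs \<subseteq> carrier (Zmod n) \<longrightarrow>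
           (\<exists>ys. ys \<noteq> [] \<and> subseq ys xs \<and> weighted_zero_sum2 n A B ys)))"

end

theory Submission
  imports Defs
begin

text \<open>
  If \<open>n \<ge> 3\<close>, any two or more nonzero weights \<open>a\<^sub>i\<close> admit nonzero \<open>b\<^sub>i\<close> with \<open>\<Sum> b\<^sub>i a\<^sub>i = 0\<close>, and a
  single nonzero \<open>a\<close> admits such a \<open>b\<close> iff it is not a unit. Hence the second condition
  only excludes zero-sum subsequences of length one with a unit weight, whose term must be \<open>0\<close>.
  If \<open>A\<close> contains a nonunit, that weight may be used for the term \<open>0\<close> instead, so nothing changes.
  If \<open>A\<close> consists of units, adjoining a term \<open>0\<close> to a sequence costs exactly one: it is useless
  alone, and it lengthens every other zero-sum subsequence. The case \<open>n = 2\<close> is direct.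
\<close>

section \<open>Integer dot products of lists\<close>

text \<open>Taken over the integers without reduction, so that vanishing in \<open>Zmod n\<close>
  becomes divisibility by \<open>n\<close> and proofs can go by list induction.\<close>

definition dot :: "int list \<Rightarrow> int list \<Rightarrow> int" where
  "dot as xs = sum_list (map2 (*) as xs)"

lemma dot_simps [simp]:
  "dot [] xs = 0"
  "dot as [] = 0"
  "dot (a # as) (x # xs) = a * x + dot as xs"
  by (simp_all add: dot_def)

lemma dot_append:
  "length as = length xs \<Longrightarrow> dot (as @ bs) (xs @ ys) = dot as xs + dot bs ys"
  by (simp add: dot_def)

lemma dot_replicate: "dot (replicate (length xs) a) xs = a * sum_list xs"
  by (induction xs) (simp_all add: algebra_simps)

lemma dot_conv_sum:
  "length as = length xs \<Longrightarrow> dot as xs = (\<Sum>i<length xs. as ! i * xs ! i)"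
  by (simp add: dot_def sum_list_sum_nth atLeast0LessThan)

text \<open>Allows coefficients to be chosen as arbitrary integers and reduced to residues only at
  the end.\<close>

lemma dot_mod_cong: "[dot (map (\<lambda>b. b mod m) bs) as = dot bs as] (mod m)"
proof (induction bs arbitrary: as)
  case (Cons b bs)
  show ?case
  proof (cases as)
    case (Cons a as')
    have "[b mod m * a = b * a] (mod m)" by (simp add: cong_def mod_mult_left_eq)
    then have "[b mod m * a + dot (map (\<lambda>b. b mod m) bs) as' = b * a + dot bs as'] (mod m)"
      using Cons.IH by (rule cong_add)
    then show ?thesis using Cons by simp
  qed simp
qed simp

section \<open>Solving a linear congruence with all coefficients nonzero\<close>

text \<open>The witness is \<open>m div gcd a m\<close>: as the gcd exceeds 1, it lies strictly
  between 0 and \<open>m\<close>.\<close>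

lemma nonunit_annihilator:
  fixes a m :: int
  assumes "m > 0" "\<not> coprime a m"
  obtains b where "\<not> m dvd b" "m dvd b * a"
proof
  let ?g = "gcd a m"
  have m: "m = m div ?g * ?g" and a: "a = a div ?g * ?g" by simp_all
  have g: "?g > 1"
    using assms by (metis coprime_iff_gcd_eq_1 gcd_pos_int less_irrefl linorder_neqE_linordered_idom
        int_one_le_iff_zero_less order_le_less)
  have "0 < m div ?g" using assms(1) by (simp add: pos_imp_zdiv_pos_iff zdvd_imp_le)
  moreover have "m div ?g < m" using assms(1) g by (intro int_div_less_self)
  ultimately show "\<not> m dvd m div ?g" by (simp add: zdvd_not_zless)
  have "m div ?g * a = m * (a div ?g)"
    by (metis a m mult.assoc mult.commute)
  then show "m dvd m div ?g * a" by simp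
qed

text \<open>Prepares the tail for the solvability lemma below. A nonunit head is annihilated; for a
  unit head \<open>a\<close> the coefficients 1 and -1 give values differing by
  \<open>2 * a\<close>, so they cannot both vanish. This is where \<open>m\<close> must exceed 2:
  modulo 2 the weights 1, 1 only give 0.\<close>

lemma dot_nonzero_coeffs_ne_0:
  fixes m :: int
  assumes "m \<ge> 3" "as \<noteq> []" "\<forall>a\<in>set as. \<not> m dvd a"
  shows "\<exists>bs. length bs = length as \<and> (\<forall>b\<in>set bs. \<not> m dvd b) \<and> \<not> m dvd dot bs as"
  using assms(2,3)
proof (induction as rule: list_nonempty_induct)
  case (single a)
  have "\<not> m dvd 1" using assms(1) by (simp add: zdvd_not_zless)
  then show ?case using single by (intro exI[of _ "[1]"]) simp
next
  case (cons a as)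
  then obtain bs where bs: "length bs = length as" "\<forall>b\<in>set bs. \<not> m dvd b" "\<not> m dvd dot bs as"
    by auto
  have "\<exists>b. \<not> m dvd b \<and> \<not> m dvd b * a + dot bs as"
  proof (cases "coprime a m")
    case True
    have "\<not> m dvd 1" "\<not> m dvd 2" using assms(1) by (simp_all add: zdvd_not_zless)
    have "\<not> m dvd 2 * a"
      using True \<open>\<not> m dvd 2\<close> by (simp add: coprime_dvd_mult_left_iff coprime_commute)
    moreover have "2 * a = (1 * a + dot bs as) - (-1 * a + dot bs as)" by simp
    ultimately have "\<not> m dvd 1 * a + dot bs as \<or> \<not> m dvd -1 * a + dot bs as"
      by (metis dvd_diff)
    moreover have "\<not> m dvd -1" using \<open>\<not> m dvd 1\<close> by simp
    ultimately show ?thesis using \<open>\<not> m dvd 1\<close> by blast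
  next
    case False
    obtain b where "\<not> m dvd b" "m dvd b * a"
      using nonunit_annihilator[OF _ False] assms(1) by auto
    then show ?thesis using bs(3) by (auto simp: dvd_add_right_iff)
  qed
  then obtain b where "\<not> m dvd b" "\<not> m dvd b * a + dot bs as" by blast
  then show ?case using bs by (intro exI[of _ "b # bs"]) simp
qed

text \<open>Induction down to two weights. A nonunit head is annihilated and the tail is solved by
  induction; with a unit head the tail is given a nonzero value, which the head then
  cancels.\<close>

lemma dot_nonzero_coeffs_eq_0:
  fixes m :: int
  assumes m: "m \<ge> 3" and "length as \<ge> 2" "\<forall>a\<in>set as. \<not> m dvd a"
  shows "\<exists>bs. length bs = length as \<and> (\<forall>b\<in>set bs. \<not> m dvd b) \<and> m dvd dot bs as"
  using assms(2,3)
proof (induction as)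
  case (Cons a as)
  show ?case
  proof (cases "length as \<ge> 2")
    case False
    then obtain c where as: "as = [c]" using Cons.prems(1) by (cases as; cases "tl as") auto
    then show ?thesis using Cons.prems(2) by (intro exI[of _ "[c, -a]"]) simp
  next
    case long: True
    have nz: "\<forall>a\<in>set as. \<not> m dvd a" using Cons.prems by simp
    show ?thesis
    proof (cases "coprime a m")
      case True
      obtain bs where bs: "length bs = length as" "\<forall>b\<in>set bs. \<not> m dvd b" "\<not> m dvd dot bs as"
        using dot_nonzero_coeffs_ne_0[OF m _ nz] long by fastforce
      obtain c where c: "[a * c = 1] (mod m)" using cong_solve_coprime_int[OF True] by blast
      \<comment> \<open>The solution of \<open>b * a + dot bs as = 0\<close> modulo
        \<open>m\<close>, with \<open>c\<close> the inverse of \<open>a\<close>. It is nonzero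
        because otherwise \<open>dot bs as\<close> would vanish too.\<close>
      let ?b = "- (c * dot bs as)"
      have eq: "?b * a + dot bs as = (1 - a * c) * dot bs as" by (simp add: algebra_simps)
      have "m dvd 1 - a * c" using c by (metis cong_iff_dvd_diff cong_sym)
      then have dvd: "m dvd ?b * a + dot bs as" unfolding eq by simp
      moreover have "\<not> m dvd ?b"
        using bs(3) dvd by (meson dvd_add_right_iff dvd_mult2)
      ultimately show ?thesis using bs by (intro exI[of _ "?b # bs"]) simp
    next
      case False
      obtain b where "\<not> m dvd b" "m dvd b * a"
        using nonunit_annihilator[OF _ False] m by auto
      moreover obtain bs where "length bs = length as" "\<forall>b\<in>set bs. \<not> m dvd b" "m dvd dot bs as"
        using Cons.IH[OF long nz] by auto
      ultimately show ?thesis by (intro exI[of _ "b # bs"]) simp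
    qed
  qed
qed simp

section \<open>From the residue ring to integer divisibility\<close>

lemma residues_Zmod: "n \<ge> 2 \<Longrightarrow> residues (int n)"
  by unfold_locales simp

lemma carrier_Zmod: "carrier (Zmod n) = {0..<int n}"
  by (auto simp: residue_ring_def)

lemma zero_Zmod: "\<zero>\<^bsub>Zmod n\<^esub> = 0"
  by (simp add: residue_ring_def)

lemma nonzero_residues_eq: "nonzero_residues n = {0<..<int n}"
  by (auto simp: nonzero_residues_def carrier_Zmod zero_Zmod)

lemma nonzero_residues_not_dvd: "a \<in> nonzero_residues n \<Longrightarrow> \<not> int n dvd a"
  by (simp add: nonzero_residues_eq zdvd_not_zless)

lemma Units_Zmod:
  assumes "n \<ge> 2"
  shows "Units (Zmod n) = {x \<in> nonzero_residues n. coprime x (int n)}"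
  using residues.res_units_eq[OF residues_Zmod[OF assms]] by (auto simp: nonzero_residues_eq)

lemma finsum_Zmod:
  assumes "n \<ge> 2" "finite I"
  shows "(\<Oplus>\<^bsub>Zmod n\<^esub> i \<in> I. f i mod int n) = (\<Sum>i\<in>I. f i) mod int n"
proof -
  interpret residues "int n" "Zmod n" using residues_Zmod[OF assms(1)] by simp_all
  have c: "f i mod int n \<in> carrier (Zmod n)" for i using assms(1) by (simp add: carrier_Zmod)
  show ?thesis using assms(2)
  proof (induction I rule: finite_induct)
    case empty
    then show ?case by (simp add: zero_Zmod)
  next
    case (insert i I)
    then show ?case using c by (subst finsum_insert) (auto simp: res_add_eq mod_simps)
  qed
qed

lemma weighted_sum_eq:
  assumes "n \<ge> 2" "length as = length xs"
  shows "weighted_sum n as xs = dot as xs mod int n"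
  unfolding weighted_sum_def residues.res_mult_eq[OF residues_Zmod[OF assms(1)]]
  by (simp add: finsum_Zmod assms dot_conv_sum)

lemma weighted_zero_sum_iff:
  assumes "n \<ge> 2"
  shows "weighted_zero_sum n A xs \<longleftrightarrow>
    (\<exists>as. length as = length xs \<and> set as \<subseteq> A \<and> int n dvd dot as xs)"
  unfolding weighted_zero_sum_def zero_Zmod
  by (metis assms weighted_sum_eq dvd_eq_mod_eq_0)

text \<open>The second coefficients may be any integers not divisible by \<open>n\<close>, so
  negative ones such as those built above are admissible; reduction modulo \<open>n\<close> brings
  them back to nonzero residues.\<close>

lemma weighted_zero_sum2_iff:
  assumes "n \<ge> 2"
  shows "weighted_zero_sum2 n A (nonzero_residues n) xs \<longleftrightarrow>
    (\<exists>as. length as = length xs \<and> set as \<subseteq> A \<and> int n dvd dot as xs \<and>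
      (\<exists>bs. length bs = length as \<and> (\<forall>b\<in>set bs. \<not> int n dvd b) \<and> int n dvd dot bs as))"
    (is "?L \<longleftrightarrow> ?R")
proof
  assume ?L
  then obtain as bs where "length as = length xs" "set as \<subseteq> A" "length bs = length as"
    "set bs \<subseteq> nonzero_residues n" "int n dvd dot as xs" "int n dvd dot bs as"
    unfolding weighted_zero_sum2_def zero_Zmod
    by (metis assms weighted_sum_eq dvd_eq_mod_eq_0)
  then show ?R using nonzero_residues_not_dvd by blast
next
  assume ?R
  then obtain as bs where as: "length as = length xs" "set as \<subseteq> A" "int n dvd dot as xs"
    and bs: "length bs = length as" "\<forall>b\<in>set bs. \<not> int n dvd b" "int n dvd dot bs as"
    by blast
  let ?bs = "map (\<lambda>b. b mod int n) bs"
  have "b mod int n \<in> nonzero_residues n" if "b \<in> set bs" for b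
    using bs(2) that assms unfolding nonzero_residues_eq
    by (auto simp: dvd_eq_mod_eq_0 order_less_le[of 0])
  then have "set ?bs \<subseteq> nonzero_residues n" by auto
  moreover have "int n dvd dot ?bs as"
    using bs(3) dot_mod_cong cong_dvd_iff by blast
  ultimately show ?L
    unfolding weighted_zero_sum2_def zero_Zmod using as bs(1) assms
    by (intro exI[of _ as] exI[of _ ?bs]) (simp add: weighted_sum_eq)
qed

section \<open>Comparing the two kinds of zero-sum sequence\<close>

lemma weighted_zero_sum2_imp:
  "weighted_zero_sum2 n A B xs \<Longrightarrow> weighted_zero_sum n A xs"
  unfolding weighted_zero_sum2_def weighted_zero_sum_def by blast

text \<open>The weights of the given zero sum are kept: being at least two and nonzero, they satisfy
  the second condition automatically.\<close>

lemma weighted_zero_sum2_of_length_ge_2: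
  assumes "n \<ge> 3" "A \<subseteq> nonzero_residues n" "length xs \<ge> 2" "weighted_zero_sum n A xs"
  shows "weighted_zero_sum2 n A (nonzero_residues n) xs"
proof -
  obtain as where as: "length as = length xs" "set as \<subseteq> A" "int n dvd dot as xs"
    using assms by (auto simp: weighted_zero_sum_iff)
  then have "\<forall>a\<in>set as. \<not> int n dvd a" using assms(2) nonzero_residues_not_dvd by blast
  then have "\<exists>bs. length bs = length as \<and> (\<forall>b\<in>set bs. \<not> int n dvd b) \<and> int n dvd dot bs as"
    using dot_nonzero_coeffs_eq_0[of "int n" as] as(1) assms(1,3) by simp
  moreover have "n \<ge> 2" using assms(1) by simp
  ultimately show ?thesis unfolding weighted_zero_sum2_iff[OF \<open>n \<ge> 2\<close>] using as by blast
qed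

lemma weighted_zero_sum2_singleton_zero:
  assumes "n \<ge> 2" "c \<in> A" "\<not> coprime c (int n)"
  shows "weighted_zero_sum2 n A (nonzero_residues n) [0]"
proof -
  obtain b where "\<not> int n dvd b" "int n dvd b * c"
    using nonunit_annihilator[OF _ assms(3)] assms(1) by auto
  then show ?thesis unfolding weighted_zero_sum2_iff[OF assms(1)]
    using assms(2) by (intro exI[of _ "[c]"]) (auto intro!: exI[of _ "[b]"])
qed

text \<open>A unit weight can be cancelled from \<open>b * a = 0\<close>, which would force
  \<open>b\<close> to vanish.\<close>

lemma not_weighted_zero_sum2_singleton:
  assumes "n \<ge> 2" "A \<subseteq> Units (Zmod n)"
  shows "\<not> weighted_zero_sum2 n A (nonzero_residues n) [x]"
proof
  assume "weighted_zero_sum2 n A (nonzero_residues n) [x]"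
  then obtain a b where "a \<in> A" "\<not> int n dvd b" "int n dvd b * a"
    unfolding weighted_zero_sum2_iff[OF assms(1)] by (auto simp: length_Suc_conv)
  moreover have "coprime (int n) a"
    using \<open>a \<in> A\<close> assms by (auto simp: Units_Zmod coprime_commute)
  ultimately show False by (simp add: coprime_dvd_mult_left_iff)
qed

lemma weighted_zero_sum_singleton:
  assumes "n \<ge> 2" "x \<in> carrier (Zmod n)" "weighted_zero_sum n A [x]"
  obtains a where "a \<in> A" "int n dvd a * x" "coprime a (int n) \<Longrightarrow> x = 0"
proof -
  obtain a where a: "a \<in> A" "int n dvd a * x"
    using assms(3) unfolding weighted_zero_sum_iff[OF assms(1)] by (auto simp: length_Suc_conv)
  have "x = 0" if "coprime a (int n)"
  proof -
    have "int n dvd x" using a(2) that by (simp add: coprime_dvd_mult_right_iff coprime_commute)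
    then show ?thesis using assms(2) by (auto simp: carrier_Zmod dest: zdvd_imp_le)
  qed
  then show ?thesis using a that by blast
qed

text \<open>Any weight may be put on the new term. This lengthens a zero-sum sequence by one, which
  turns a singleton into a sequence of length two.\<close>

lemma weighted_zero_sum_insert_zero:
  assumes "n \<ge> 2" "A \<noteq> {}" "weighted_zero_sum n A (xs @ ys)"
  shows "weighted_zero_sum n A (xs @ 0 # ys)"
proof -
  obtain as where as: "length as = length (xs @ ys)" "set as \<subseteq> A" "int n dvd dot as (xs @ ys)"
    using assms by (auto simp: weighted_zero_sum_iff)
  obtain a where "a \<in> A" using assms(2) by blast
  define us vs where "us = take (length xs) as" and "vs = drop (length xs) as"
  have len: "length us = length xs" and uv: "as = us @ vs"
    using as(1) by (simp_all add: us_def vs_def)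
  have "int n dvd dot (us @ a # vs) (xs @ 0 # ys)"
    using as(3) len by (simp add: uv dot_append)
  then show ?thesis unfolding weighted_zero_sum_iff[OF assms(1)]
    using as uv \<open>a \<in> A\<close> by (intro exI[of _ "us @ a # vs"]) simp
qed

section \<open>Lengths that force a zero-sum subsequence\<close>

text \<open>The common body of both \<open>LEAST\<close> predicates with the zero-sum notion as a
  parameter, so that the constants can be compared length by length.\<close>

definition forces_zero_sum :: "nat \<Rightarrow> (int list \<Rightarrow> bool) \<Rightarrow> nat \<Rightarrow> bool" where
  "forces_zero_sum n P k \<longleftrightarrow> (\<forall>xs. length xs = k \<and> set xs \<subseteq> carrier (Zmod n) \<longrightarrow>
     (\<exists>ys. ys \<noteq> [] \<and> subseq ys xs \<and> P ys))"

lemma davenport_const_eq: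
  "davenport_const A n = (LEAST k. 0 < k \<and> forces_zero_sum n (weighted_zero_sum n A) k)"
  by (simp add: davenport_const_def forces_zero_sum_def)

lemma davenport_const2_eq:
  "davenport_const2 A B n = (LEAST k. 0 < k \<and> forces_zero_sum n (weighted_zero_sum2 n A B) k)"
  by (simp add: davenport_const2_def forces_zero_sum_def)

lemma forces_zero_sumD:
  assumes "forces_zero_sum n P k" "length xs = k" "set xs \<subseteq> carrier (Zmod n)"
  obtains ys where "ys \<noteq> []" "subseq ys xs" "P ys"
  using assms unfolding forces_zero_sum_def by blast

lemma forces_zero_sum_self:
  assumes "n \<ge> 2" "A \<noteq> {}"
  shows "forces_zero_sum n (weighted_zero_sum n A) n"
  unfolding forces_zero_sum_def
proof (intro allI impI)
  fix xs :: "int list"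
  assume xs: "length xs = n \<and> set xs \<subseteq> carrier (Zmod n)"
  define s where "s i = sum_list (take i xs) mod int n" for i
  \<comment> \<open>The empty partial sum counts too: \<open>n + 1\<close> indices compete for
    \<open>n\<close> residues.\<close>
  have "s ` {0..n} \<subseteq> {0..<int n}" using assms(1) by (auto simp: s_def)
  then have "card (s ` {0..n}) \<le> card {0..<int n}" by (intro card_mono) auto
  then have "\<not> inj_on s {0..n}" by (intro pigeonhole) simp
  then obtain i j where ij: "i < j" "j \<le> n" "s i = s j"
    unfolding inj_on_def by (metis atLeastAtMost_iff linorder_neqE_nat)
  define ys where "ys = drop i (take j xs)"
  have "take i xs = take i (take j xs)" using ij(1) by (simp add: min_def)
  then have "take j xs = take i xs @ ys" by (metis ys_def append_take_drop_id)
  then have "sum_list ys = sum_list (take j xs) - sum_list (take i xs)" by simp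
  then have "int n dvd sum_list ys"
    using ij(3) unfolding s_def by (metis mod_eq_dvd_iff)
  moreover obtain a where "a \<in> A" using assms(2) by blast
  ultimately have "weighted_zero_sum n A ys"
    unfolding weighted_zero_sum_iff[OF assms(1)]
    by (intro exI[of _ "replicate (length ys) a"]) (auto simp: dot_replicate)
  moreover have "ys \<noteq> []" using ij xs by (simp add: ys_def)
  moreover have "subseq ys xs"
    unfolding ys_def by (metis append_take_drop_id list_emb_append2 subseq_order.refl
        subseq_append_iff subseq_drop_many subseq_rev_drop_many)
  ultimately show "\<exists>ys. ys \<noteq> [] \<and> subseq ys xs \<and> weighted_zero_sum n A ys" by blast
qed

section \<open>Transfer of forcing lengths between the two notions\<close>

lemma forces_zero_sum2_imp:
  "forces_zero_sum n (weighted_zero_sum2 n A B) k \<Longrightarrow> forces_zero_sum n (weighted_zero_sum n A) k"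
  unfolding forces_zero_sum_def using weighted_zero_sum2_imp by blast

text \<open>The subsequence found for \<open>A\<close> itself works; only the weight of a single
  term may have to be changed.\<close>

lemma forces_zero_sum2_nonunit:
  assumes n: "n \<ge> 2" and A: "A \<subseteq> nonzero_residues n" "\<not> A \<subseteq> Units (Zmod n)"
    and "forces_zero_sum n (weighted_zero_sum n A) k"
  shows "forces_zero_sum n (weighted_zero_sum2 n A (nonzero_residues n)) k"
  unfolding forces_zero_sum_def
proof (intro allI impI)
  fix xs :: "int list"
  assume xs: "length xs = k \<and> set xs \<subseteq> carrier (Zmod n)"
  then obtain ys where ys: "ys \<noteq> []" "subseq ys xs" "weighted_zero_sum n A ys"
    using assms(4) forces_zero_sumD by metis
  obtain c where c: "c \<in> A" "\<not> coprime c (int n)" using A by (auto simp: Units_Zmod[OF n])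
  \<comment> \<open>Modulo 2 the only nonzero residue is the unit 1, so a nonunit weight excludes
    this case.\<close>
  have "n \<noteq> 2" using c A(1) by (force simp: nonzero_residues_eq)
  then have n3: "n \<ge> 3" using n by simp
  have "weighted_zero_sum2 n A (nonzero_residues n) ys"
  proof (cases "length ys \<ge> 2")
    case True
    then show ?thesis using weighted_zero_sum2_of_length_ge_2[OF n3 A(1)] ys(3) by blast
  next
    case False
    then obtain y where y: "ys = [y]" using ys(1) by (cases ys; cases "tl ys") auto
    have "y \<in> carrier (Zmod n)" using ys(2) xs y by (auto simp: subseq_singleton_left)
    then obtain a where a: "a \<in> A" "int n dvd a * y" "coprime a (int n) \<Longrightarrow> y = 0"
      using weighted_zero_sum_singleton[OF n] ys(3) y by blast
    show ?thesis
    proof (cases "coprime a (int n)")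
      case True
      \<comment> \<open>A unit weight forces the term 0, on which the nonunit \<open>c\<close>
        serves instead.\<close>
      then show ?thesis using a(3) y weighted_zero_sum2_singleton_zero[OF n c] by simp
    next
      case False
      obtain b where "\<not> int n dvd b" "int n dvd b * a"
        using nonunit_annihilator[OF _ False] n by auto
      then show ?thesis unfolding weighted_zero_sum2_iff[OF n] y
        using a by (intro exI[of _ "[a]"]) (auto intro!: exI[of _ "[b]"])
    qed
  qed
  then show "\<exists>ys. ys \<noteq> [] \<and> subseq ys xs \<and> weighted_zero_sum2 n A (nonzero_residues n) ys"
    using ys by blast
qed

text \<open>A term 0 is prepended. If the subsequence found uses it, dropping it leaves the sum
  unchanged, and something remains since \<open>[0]\<close> alone fails for unit weights.\<close>

lemma forces_zero_sum_of_Suc: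
  assumes n: "n \<ge> 2" and A: "A \<subseteq> Units (Zmod n)"
    and "forces_zero_sum n (weighted_zero_sum2 n A (nonzero_residues n)) (Suc k)"
  shows "forces_zero_sum n (weighted_zero_sum n A) k"
  unfolding forces_zero_sum_def
proof (intro allI impI)
  fix xs :: "int list"
  assume xs: "length xs = k \<and> set xs \<subseteq> carrier (Zmod n)"
  then have "length (0 # xs) = Suc k" "set (0 # xs) \<subseteq> carrier (Zmod n)"
    using n by (auto simp: carrier_Zmod)
  then obtain ys where ys: "ys \<noteq> []" "subseq ys (0 # xs)"
    "weighted_zero_sum2 n A (nonzero_residues n) ys"
    using assms(3) forces_zero_sumD by metis
  show "\<exists>ys. ys \<noteq> [] \<and> subseq ys xs \<and> weighted_zero_sum n A ys"
  proof (cases "subseq ys xs")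
    case True
    then show ?thesis using ys weighted_zero_sum2_imp by blast
  next
    case False
    then obtain zs where zs: "ys = 0 # zs" "subseq zs xs"
      using ys(1,2) by (cases ys) (auto split: if_splits)
    have "zs \<noteq> []" using not_weighted_zero_sum2_singleton[OF n A] ys(3) zs(1) by auto
    moreover have "weighted_zero_sum n A zs"
      using weighted_zero_sum2_imp[OF ys(3)]
      unfolding zs(1) weighted_zero_sum_iff[OF n] by (auto simp: length_Suc_conv)
    ultimately show ?thesis using zs(2) by blast
  qed
qed

text \<open>Here all weights and coefficients are 1, so the second condition says that the length is
  even. Two equal terms suffice, and three terms modulo 2 always contain such a pair.\<close>

lemma forces_zero_sum2_two:
  assumes A: "A \<noteq> {}" "A \<subseteq> nonzero_residues 2"
    and "forces_zero_sum 2 (weighted_zero_sum 2 A) k" "0 < k"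
  shows "forces_zero_sum 2 (weighted_zero_sum2 2 A (nonzero_residues 2)) (Suc k)"
  unfolding forces_zero_sum_def
proof (intro allI impI)
  fix xs :: "int list"
  assume xs: "length xs = Suc k \<and> set xs \<subseteq> carrier (Zmod 2)"
  have "A \<subseteq> {1}" using A(2) by (force simp: nonzero_residues_eq)
  then have A1: "A = {1}" using A(1) by blast
  \<comment> \<open>The sequence \<open>[1]\<close> has no zero sum, so \<open>Suc k\<close> is at
    least 3.\<close>
  have "k \<noteq> 1"
  proof
    assume "k = 1"
    then obtain ys where "ys \<noteq> []" "subseq ys [1]" "weighted_zero_sum 2 A ys"
      using forces_zero_sumD[OF assms(3), of "[1]"] carrier_Zmod[of 2] by auto
    moreover from this have "ys = [1]" by (cases ys) (auto split: if_splits)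
    ultimately show False
      unfolding A1 by (auto simp: weighted_zero_sum_iff length_Suc_conv)
  qed
  then obtain x y z zs where xyz: "xs = x # y # z # zs"
    using xs \<open>0 < k\<close> by (cases xs; cases "tl xs"; cases "tl (tl xs)") auto
  have "{x, y, z} \<subseteq> {0, 1}" using xs carrier_Zmod[of 2] by (force simp: xyz)
  then have "x = y \<or> x = z \<or> y = z" by auto
  then have "subseq [x, x] xs \<or> subseq [z, z] xs"
    by (auto simp: xyz subseq_singleton_left)
  then obtain u where "subseq [u, u] xs" by blast
  moreover have "weighted_zero_sum2 2 A (nonzero_residues 2) [u, u]"
    by (subst weighted_zero_sum2_iff)
      (auto simp: A1 intro!: exI[of _ "[1, 1]"])
  ultimately show "\<exists>ys. ys \<noteq> [] \<and> subseq ys xs \<and> weighted_zero_sum2 2 A (nonzero_residues 2) ys"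
    by blast
qed

text \<open>For \<open>n\<close> at least 3 it is enough to find a zero-sum subsequence with two or
  more terms. One spare term provides it: a 0 is set aside and reinserted, and in the absence of
  zeros no single term can be a zero sum with a unit weight.\<close>

lemma forces_zero_sum2_Suc:
  assumes n: "n \<ge> 2" and A: "A \<noteq> {}" "A \<subseteq> Units (Zmod n)"
    and k: "forces_zero_sum n (weighted_zero_sum n A) k" "0 < k"
  shows "forces_zero_sum n (weighted_zero_sum2 n A (nonzero_residues n)) (Suc k)"
proof (cases "n = 2")
  case True
  have "A \<subseteq> nonzero_residues 2" using A(2) unfolding True Units_Zmod[OF order_refl] by blast
  then show ?thesis using forces_zero_sum2_two[OF A(1)] k True by blast
next
  case False
  then have n3: "n \<ge> 3" using n by simp
  have A': "A \<subseteq> nonzero_residues n" using A by (auto simp: Units_Zmod[OF n])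
  show ?thesis unfolding forces_zero_sum_def
  proof (intro allI impI)
    fix xs :: "int list"
    assume xs: "length xs = Suc k \<and> set xs \<subseteq> carrier (Zmod n)"
    have "\<exists>ys. length ys \<ge> 2 \<and> subseq ys xs \<and> weighted_zero_sum n A ys"
    proof (cases "0 \<in> set xs")
      case True
      then obtain us vs where uv: "xs = us @ 0 # vs" by (meson split_list)
      obtain ys where ys: "ys \<noteq> []" "subseq ys (us @ vs)" "weighted_zero_sum n A ys"
        using forces_zero_sumD[OF k(1), of "us @ vs"] xs by (auto simp: uv)
      then obtain ys1 ys2 where ys12: "ys = ys1 @ ys2" "subseq ys1 us" "subseq ys2 vs"
        by (auto simp: subseq_append_iff)
      have "length (ys1 @ 0 # ys2) \<ge> 2"
        using ys(1) unfolding ys12(1) by (cases ys1; cases ys2) auto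
      moreover have "subseq (ys1 @ 0 # ys2) xs"
        unfolding uv using ys12 by (intro list_emb_append_mono) auto
      moreover have "weighted_zero_sum n A (ys1 @ 0 # ys2)"
        using weighted_zero_sum_insert_zero[OF n A(1)] ys(3) ys12(1) by blast
      ultimately show ?thesis by blast
    next
      case False
      \<comment> \<open>The head is dropped merely to reach length \<open>k\<close>.\<close>
      obtain x xs' where x: "xs = x # xs'" using xs by (cases xs) auto
      then obtain ys where ys: "ys \<noteq> []" "subseq ys xs'" "weighted_zero_sum n A ys"
        using forces_zero_sumD[OF k(1), of xs'] xs by auto
      have "\<not> length ys < 2"
      proof
        assume "length ys < 2"
        then obtain y where y: "ys = [y]" using ys(1) by (cases ys; cases "tl ys") auto
        have "y \<in> set xs" using ys(2) x y by (auto simp: subseq_singleton_left)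
        moreover have "y = 0"
          using weighted_zero_sum_singleton[OF n, of y A] \<open>y \<in> set xs\<close> xs ys(3) A(2)
          by (auto simp: y Units_Zmod[OF n])
        ultimately show False using False by simp
      qed
      then show ?thesis using ys x by (intro exI[of _ ys]) auto
    qed
    then show "\<exists>ys. ys \<noteq> [] \<and> subseq ys xs \<and> weighted_zero_sum2 n A (nonzero_residues n) ys"
      using weighted_zero_sum2_of_length_ge_2[OF n3 A']
      by (metis le_zero_eq list.size(3) zero_neq_numeral)
  qed
qed

text \<open>The sequence \<open>[0]\<close> is the counterexample. This keeps the predecessor of a
  forcing length positive, as the \<open>LEAST\<close> predicate requires.\<close>

lemma not_forces_zero_sum2_one:
  assumes "n \<ge> 2" "A \<subseteq> Units (Zmod n)"
  shows "\<not> forces_zero_sum n (weighted_zero_sum2 n A (nonzero_residues n)) 1"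
proof
  assume "forces_zero_sum n (weighted_zero_sum2 n A (nonzero_residues n)) 1"
  then obtain ys where "ys \<noteq> []" "subseq ys [0]" "weighted_zero_sum2 n A (nonzero_residues n) ys"
    using forces_zero_sumD[of n _ 1 "[0]"] assms(1) by (auto simp: carrier_Zmod)
  moreover from this have "ys = [0]" by (cases ys) (auto split: if_splits)
  ultimately show False using not_weighted_zero_sum2_singleton[OF assms] by blast
qed

theorem theorem14:
  fixes n :: nat and A :: "int set"
  assumes "n \<ge> 2"
  shows "(A \<noteq> {} \<and> A \<subseteq> Units (Zmod n) \<longrightarrow>
            davenport_const2 A (nonzero_residues n) n = davenport_const A n + 1) \<and>
         (A \<noteq> {} \<and> A \<subseteq> nonzero_residues n \<and> \<not> A \<subseteq> Units (Zmod n) \<longrightarrow>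
            davenport_const2 A (nonzero_residues n) n = davenport_const A n)"
proof (intro conjI impI)
  assume A: "A \<noteq> {} \<and> A \<subseteq> Units (Zmod n)"
  let ?P = "\<lambda>k. 0 < k \<and> forces_zero_sum n (weighted_zero_sum n A) k"
  let ?Q = "\<lambda>k. 0 < k \<and> forces_zero_sum n (weighted_zero_sum2 n A (nonzero_residues n)) k"
  have P: "?P (Least ?P)"
    using forces_zero_sum_self[OF assms, of A] A assms by (intro LeastI[of ?P n]) auto
  have "Least ?Q = Suc (Least ?P)"
  proof (rule Least_equality)
    show "?Q (Suc (Least ?P))" using forces_zero_sum2_Suc[OF assms] A P by blast
  next
    fix k assume k: "?Q k"
    then obtain j where j: "k = Suc j" by (cases k) auto
    have "j \<noteq> 0" using k not_forces_zero_sum2_one[OF assms] A by (auto simp: j)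
    moreover have "forces_zero_sum n (weighted_zero_sum n A) j"
      using forces_zero_sum_of_Suc[OF assms] A k by (auto simp: j)
    ultimately have "Least ?P \<le> j" by (intro Least_le) simp
    then show "Suc (Least ?P) \<le> k" by (simp add: j)
  qed
  then show "davenport_const2 A (nonzero_residues n) n = davenport_const A n + 1"
    by (simp add: davenport_const_eq davenport_const2_eq)
next
  assume "A \<noteq> {} \<and> A \<subseteq> nonzero_residues n \<and> \<not> A \<subseteq> Units (Zmod n)"
  \<comment> \<open>The two forcing predicates agree at every length, hence so do their least
    positive values.\<close>
  then have "forces_zero_sum n (weighted_zero_sum2 n A (nonzero_residues n)) k \<longleftrightarrow>
      forces_zero_sum n (weighted_zero_sum n A) k" for k
    using forces_zero_sum2_nonunit[OF assms] forces_zero_sum2_imp by blast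
  then show "davenport_const2 A (nonzero_residues n) n = davenport_const A n"
    by (simp add: davenport_const_eq davenport_const2_eq)
qed

end
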